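(* Let $d\ge3$ and let $S$ be a subordinator with Laplace exponent $\phi$ such that: (1) for some $\alpha\in[0,2]$, $\displaystyle\lim_{\lambda\to+\infty}\frac{\phi'(\lambda x)}{\phi'(\lambda)}=x^{\frac{\alpha}{2}-1}$ for every $x>0$; (2) the Lévy measure of $S$ is infinite and has a decreasing density $\mu$ on $(0,\infty)$. Let $X$ be the corresponding subordinate Brownian motion in $\mathbb{R}^d$, whose Lévy measure has density $x\mapsto j(|x|)$. If $\alpha\in[0,2)$, then $$j(r)\asymp r^{-d-2}\phi'(r^{-2}),\quad r\to0+ .$$ If $\alpha=2$ and, in addition, $\lambda\mapsto\big(\tfrac{\lambda}{\phi(\lambda)}\big)'$ varies regularly at infinity with index $-1$, then $$j(r)\asymp r^{-d-2}\big(r^2\phi(r^{-2})-\phi'(r^{-2})\big),\quad r\to0+ .$$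
   Context: A subordinator is a Lévy process $S$ in $\mathbb{R}$ with $S_0=0$ and values in $[0,\infty)$; its Laplace exponent $\phi$ is given by $\mathbb{E}e^{-\lambda S_t}=e^{-t\phi(\lambda)}$, $\lambda>0$, and has the form $\phi(\lambda)=\gamma\lambda+\int_{(0,\infty)}(1-e^{-\lambda t})\,\mu(dt)$ with $\gamma\ge0$ and Lévy measure $\mu$, $\int_{(0,\infty)}(1\wedge t)\,\mu(dt)<\infty$. When the Lévy measure has a density it is also denoted $\mu$, i.e. $\mu(dt)=\mu(t)\,dt$. "Decreasing" is meant in the non-strict sense. Let $B$ be a Brownian motion in $\mathbb{R}^d$ independent of $S$, with transition density $(4\pi t)^{-d/2}\exp(-|x-y|^2/(4t))$. The subordinate Brownian motion is $X_t=B(S_t)$. It is a Lévy process with characteristic exponent $\phi(|\xi|^2)$ and Lévy measure $j(|x|)\,dx$, where $$j(r)=\int_0^\infty(4\pi t)^{-d/2}e^{-r^2/(4t)}\mu(t)\,dt,\quad r>0 .$$ A function $f\colon(0,\infty)\to(0,\infty)$ varies regularly at infinity with index $\rho$ if $\lim_{\lambda\to+\infty}f(\lambda x)/f(\lambda)=x^\rho$ for every $x>0$. The notation $f(r)\asymp g(r)$, $r\to0+$, means that $f(r)/g(r)$ stays between two positive constants for all sufficiently small $r>0$. *)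

theory Defs
  imports "HOL-Probability.Probability"
begin

text \<open>Processes are indexed by \<^typ>\<open>real\<close>; only times \<open>t \<ge> 0\<close> are meaningful.\<close>

definition cadlag_path :: "(real \<Rightarrow> 'a::topological_space) \<Rightarrow> bool" where
  "cadlag_path f \<longleftrightarrow>
     (\<forall>t\<ge>0. (f \<longlongrightarrow> f t) (at_right t)) \<and> (\<forall>t>0. \<exists>l. (f \<longlongrightarrow> l) (at_left t))"

definition levy_process :: "'w measure \<Rightarrow> (real \<Rightarrow> 'w \<Rightarrow> 'a::euclidean_space) \<Rightarrow> bool" where
  "levy_process M Y \<longleftrightarrow>
     prob_space M \<and>
     (\<forall>t\<ge>0. Y t \<in> borel_measurable M) \<and>
     (AE \<omega> in M. Y 0 \<omega> = 0) \<and>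
     (\<forall>(n::nat) (t::nat \<Rightarrow> real). 0 \<le> t 0 \<and> mono t \<longrightarrow>
        prob_space.indep_vars M (\<lambda>_. borel) (\<lambda>i \<omega>. Y (t (Suc i)) \<omega> - Y (t i) \<omega>) {..<n}) \<and>
     (\<forall>s\<ge>0. \<forall>h\<ge>0. distr M borel (\<lambda>\<omega>. Y (s + h) \<omega> - Y s \<omega>) = distr M borel (Y h)) \<and>
     (AE \<omega> in M. cadlag_path (\<lambda>t. Y t \<omega>))"

definition subordinator :: "'w measure \<Rightarrow> (real \<Rightarrow> 'w \<Rightarrow> real) \<Rightarrow> bool" where
  "subordinator M S \<longleftrightarrow>
     levy_process M S \<and> (\<forall>t\<ge>0. \<forall>\<omega>\<in>space M. 0 \<le> S t \<omega>)"

text \<open>The exponent is only determined on \<open>(0,\<infinity>)\<close>; its values elsewhere are arbitrary.\<close>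

definition has_laplace_exponent ::
    "'w measure \<Rightarrow> (real \<Rightarrow> 'w \<Rightarrow> real) \<Rightarrow> (real \<Rightarrow> real) \<Rightarrow> bool" where
  "has_laplace_exponent M S \<phi> \<longleftrightarrow>
     (\<forall>l>0. \<forall>t\<ge>0. (\<integral>\<omega>. exp (- l * S t \<omega>) \<partial>M) = exp (- t * \<phi> l))"

text \<open>The Levy measure lives on \<open>(0,\<infinity>)\<close>; it is encoded as a Borel measure on the whole
  line that vanishes on \<open>(-\<infinity>,0]\<close>. The number \<open>\<gamma>\<close> is the drift.\<close>

definition has_levy_measure ::
    "'w measure \<Rightarrow> (real \<Rightarrow> 'w \<Rightarrow> real) \<Rightarrow> real measure \<Rightarrow> bool" where
  "has_levy_measure M S \<nu> \<longleftrightarrow>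
     sets \<nu> = sets borel \<and> emeasure \<nu> {..0} = 0 \<and>
     (\<integral>\<^sup>+t\<in>{0<..}. ennreal (min 1 t) \<partial>\<nu>) < \<infinity> \<and>
     (\<exists>\<gamma>\<ge>0. has_laplace_exponent M S
        (\<lambda>l. \<gamma> * l + (LINT t:{0<..}|\<nu>. 1 - exp (- l * t))))"

definition density_on_pos :: "(real \<Rightarrow> real) \<Rightarrow> real measure" where
  "density_on_pos \<mu> = density lborel (\<lambda>t. ennreal (\<mu> t) * indicator {0<..} t)"

text \<open>The heat kernel of the Laplacian itself, not of half of it: \<open>B t\<close> has covariance
  matrix \<open>2t I\<close>.\<close>

definition heat_kernel :: "real \<Rightarrow> 'a::euclidean_space \<Rightarrow> real" where
  "heat_kernel t x = (4 * pi * t) powr (- real DIM('a) / 2) * exp (- (norm x)\<^sup>2 / (4 * t))"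

definition brownian_motion :: "'w measure \<Rightarrow> (real \<Rightarrow> 'w \<Rightarrow> 'a::euclidean_space) \<Rightarrow> bool" where
  "brownian_motion M B \<longleftrightarrow>
     levy_process M B \<and>
     (\<forall>s\<ge>0. \<forall>t>s. distributed M lborel (\<lambda>\<omega>. B t \<omega> - B s \<omega>) (\<lambda>x. ennreal (heat_kernel (t - s) x))) \<and>
     (AE \<omega> in M. continuous_on {0..} (\<lambda>t. B t \<omega>))"

text \<open>Independence of the sigma-algebras generated by all the variables at times \<open>t \<ge> 0\<close>
  (\<^const>\<open>prob_space.indep_var\<close> would require equal state spaces).\<close>

definition process_sigma :: "'w measure \<Rightarrow> (real \<Rightarrow> 'w \<Rightarrow> 'a::topological_space) \<Rightarrow> 'w set set" where
  "process_sigma M Y =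
     sets (vimage_algebra (space M) (\<lambda>\<omega>. \<lambda>t\<in>{0..}. Y t \<omega>) (Pi\<^sub>M {0..} (\<lambda>_. borel)))"

definition indep_processes ::
    "'w measure \<Rightarrow> (real \<Rightarrow> 'w \<Rightarrow> 'a::topological_space) \<Rightarrow> (real \<Rightarrow> 'w \<Rightarrow> 'b::topological_space) \<Rightarrow> bool" where
  "indep_processes M Y Z \<longleftrightarrow> prob_space.indep_set M (process_sigma M Y) (process_sigma M Z)"

definition subordinate_brownian_motion ::
    "'w measure \<Rightarrow> (real \<Rightarrow> 'w \<Rightarrow> 'a::euclidean_space) \<Rightarrow> (real \<Rightarrow> 'w \<Rightarrow> real) \<Rightarrow>
     (real \<Rightarrow> 'w \<Rightarrow> 'a) \<Rightarrow> bool" where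
  "subordinate_brownian_motion M B S X \<longleftrightarrow>
     brownian_motion M B \<and> subordinator M S \<and> indep_processes M B S \<and>
     (\<forall>t\<ge>0. \<forall>\<omega>\<in>space M. X t \<omega> = B (S t \<omega>) \<omega>)"

text \<open>The radial profile \<open>j\<close> of the Levy density \<open>x \<mapsto> j (norm x)\<close> of the subordinate Brownian
  motion in dimension \<open>d\<close>, for a subordinator with Levy density \<open>\<mu>\<close>.\<close>

definition sbm_jump :: "nat \<Rightarrow> (real \<Rightarrow> real) \<Rightarrow> real \<Rightarrow> real" where
  "sbm_jump d \<mu> r =
     (LINT t:{0<..}|lborel. (4 * pi * t) powr (- real d / 2) * exp (- r\<^sup>2 / (4 * t)) * \<mu> t)"

definition varies_regularly_at_infinity :: "(real \<Rightarrow> real) \<Rightarrow> real \<Rightarrow> bool" where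
  "varies_regularly_at_infinity f \<rho> \<longleftrightarrow>
     (\<forall>x>0. f x > 0) \<and>
     (\<forall>x>0. ((\<lambda>l. f (l * x) / f l) \<longlongrightarrow> x powr \<rho>) at_top)"

definition comparable_at_zero :: "(real \<Rightarrow> real) \<Rightarrow> (real \<Rightarrow> real) \<Rightarrow> bool" where
  "comparable_at_zero f g \<longleftrightarrow>
     (\<exists>c>0. \<exists>C>0. eventually (\<lambda>r. c \<le> f r / g r \<and> f r / g r \<le> C) (at_right 0))"

end

theory Submission
  imports Defs "HOL-Real_Asymp.Real_Asymp"
begin

text \<open>
  Put \<open>l = r powr (-2)\<close>. After scaling, all quantities are transforms \<open>I f l = \<integral> f (l t) \<mu> t dt\<close>:
  the jump density is \<open>r powr (- d)\<close> times a constant times \<open>I K l\<close> with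
  \<open>K s = s powr (- d / 2) * exp (- 1 / (4 s))\<close>, while the two comparison functions are
  \<open>r powr (- d)\<close> times \<open>\<Phi> l = l \<phi>' l = \<gamma> l + I f l\<close> with \<open>f s = s exp (- s)\<close>, respectively
  \<open>\<Phi> l = \<phi> l - l \<phi>' l = I f l\<close> with \<open>f s = 1 - exp (- s) - s exp (- s)\<close>.

  Upper bound: \<open>K \<le> A f\<close> on \<open>(0,1]\<close>, and since \<open>K s \<le> s powr (-3/2)\<close> beyond, the rest is at most
  \<open>2 \<mu> (1 / l) / l\<close>, which is dominated by \<open>I f l\<close> because \<open>\<mu>\<close> decreases.
  Lower bound: \<open>f \<le> D K\<close> on compact subsets of \<open>(0,\<infinity>)\<close>, and near \<open>0\<close> and \<open>\<infinity>\<close> one has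
  \<open>f s \<le> a f (m s)\<close> and \<open>f s \<le> b f (k s)\<close>, so \<open>\<Phi> l \<le> D I K l + a \<Phi> (m l) + b \<Phi> (k l)\<close>. Regular
  variation of \<open>\<Phi>\<close> allows \<open>m\<close> and \<open>k\<close> to be chosen so that the last two terms are at most
  \<open>\<Phi> l / 2\<close>. If \<open>\<alpha> = 2\<close>, the regular variation of \<open>\<Phi>\<close> follows from \<open>(l / \<phi> l)' = \<Phi> l / (\<phi> l)\<^sup>2\<close> and
  l'Hopital's rule for \<open>\<phi> (x l) / \<phi> l\<close>.
\<close>

section \<open>Elementary inequalities for the exponential\<close>

text \<open>Mean value estimate on the half line up to \<open>c\<close>. It dominates the difference
  quotients of the Laplace integral in \<open>DERIV_laplace\<close>.\<close>

lemma abs_exp_diff_le: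
  fixes a b c :: real
  assumes "a \<le> c" "b \<le> c"
  shows "\<bar>exp a - exp b\<bar> \<le> \<bar>a - b\<bar> * exp c"
proof -
  have *: "\<bar>exp x - exp y\<bar> \<le> \<bar>x - y\<bar> * exp c" if "y \<le> x" "x \<le> c" for x y :: real
  proof -
    have "exp x - exp y = exp x * (1 - exp (y - x))"
      by (simp add: algebra_simps exp_diff)
    also have "\<dots> \<le> exp x * (x - y)"
    proof (rule mult_left_mono)
      show "1 - exp (y - x) \<le> x - y" using exp_ge_add_one_self[of "y - x"] by linarith
    qed simp
    also have "\<dots> \<le> exp c * (x - y)"
      using that by (intro mult_right_mono) auto
    finally show ?thesis using that by (simp add: mult.commute)
  qed
  show ?thesis
    using *[of a b] *[of b a] assms by (cases "a \<le> b") (auto simp: abs_minus_commute)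
qed

lemma mult_exp_neg_le_min:
  fixes s :: real
  assumes "0 < s"
  shows "\<bar>s * exp (- s)\<bar> \<le> min 1 s"
proof -
  have "s \<le> exp s" using exp_ge_add_one_self[of s] by linarith
  hence "s * exp (- s) \<le> 1" by (simp add: exp_minus divide_simps)
  moreover have "s * exp (- s) \<le> s * 1" using assms by (intro mult_left_mono) auto
  ultimately show ?thesis using assms by auto
qed

section \<open>Integration against a Levy measure and differentiation of its Laplace
  integral\<close>

locale levy_measure =
  fixes \<nu> :: "real measure"
  assumes sets_levy [measurable_cong]: "sets \<nu> = sets borel"
    and AE_pos: "AE t in \<nu>. 0 < t"
    and integrable_min: "integrable \<nu> (\<lambda>t. min 1 t)"
begin

text \<open>The bound survives dilation because \<open>min 1 (l * t) \<le> max 1 l * min 1 t\<close>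
  for positive \<open>t\<close>. All kernels used below satisfy such a bound.\<close>

lemma integrable_scaled:
  assumes f [measurable]: "f \<in> borel_measurable borel"
    and bound: "\<And>s. s > 0 \<Longrightarrow> \<bar>f s\<bar> \<le> C * min 1 s"
    and "0 < (l::real)"
  shows "integrable \<nu> (\<lambda>t. f (l * t) :: real)"
proof (rule Bochner_Integration.integrable_bound)
  show "integrable \<nu> (\<lambda>t. C * max 1 l * min 1 t)"
    by (intro integrable_mult_right integrable_min)
  have "0 \<le> C" using bound[of 1] by simp
  show "AE t in \<nu>. norm (f (l * t)) \<le> norm (C * max 1 l * min 1 t)"
    using AE_pos
  proof eventually_elim
    case (elim t)
    have "min 1 (l * t) \<le> max 1 l * min 1 t"
    proof (cases "t \<le> 1")
      case True
      have "l * t \<le> max 1 l * t" using elim by (intro mult_right_mono) auto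
      with True show ?thesis by simp
    qed simp
    hence "C * min 1 (l * t) \<le> C * (max 1 l * min 1 t)"
      using \<open>0 \<le> C\<close> by (rule mult_left_mono)
    with bound[of "l * t"] elim \<open>0 < l\<close> \<open>0 \<le> C\<close> show ?case
      by (simp add: mult.assoc)
  qed
qed measurable

lemma integrable_mult_exp: "0 < l \<Longrightarrow> integrable \<nu> (\<lambda>t. t * exp (- l * t))"
  using integrable_mult_right[OF integrable_scaled[of "\<lambda>s. s * exp (- s)" 1 l], of "1 / l"]
    mult_exp_neg_le_min by (simp add: field_simps)

lemma one_minus_exp_le_min: "0 < s \<Longrightarrow> \<bar>1 - exp (- s)\<bar> \<le> 1 * min 1 (s::real)"
  using exp_ge_add_one_self[of "- s"] by auto

lemma integrable_one_minus_exp: "0 < l \<Longrightarrow> integrable \<nu> (\<lambda>t. 1 - exp (- l * t))"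
  using integrable_scaled[of "\<lambda>s. 1 - exp (- s)" 1 l] one_minus_exp_le_min by simp

text \<open>Differentiation under the integral by dominated convergence along sequences: for
  increments below \<open>l / 2\<close> in modulus, the difference quotients are dominated by
  \<open>t * exp (- (l / 2) * t)\<close>.\<close>

lemma DERIV_laplace:
  assumes "0 < l"
  shows "((\<lambda>l. LINT t|\<nu>. 1 - exp (- l * t)) has_real_derivative
           (LINT t|\<nu>. t * exp (- l * t))) (at l)"
  unfolding DERIV_def tendsto_at_iff_sequentially comp_def
proof safe
  fix X :: "nat \<Rightarrow> real"
  assume X0: "\<forall>i. X i \<in> UNIV - {0}" and X: "X \<longlonglongrightarrow> 0"
  let ?q = "\<lambda>h t. ((1 - exp (- (l + h) * t)) - (1 - exp (- l * t))) / h"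
  obtain N where N: "\<And>n. n \<ge> N \<Longrightarrow> \<bar>X n\<bar> < l / 2"
    using LIMSEQ_D[OF X, of "l / 2"] assms by auto
  \<comment> \<open>Shifting the index by \<open>N\<close> makes the domination hold for every
    \<open>n\<close>; the shift is undone at the end.\<close>
  have "(\<lambda>n. LINT t|\<nu>. ?q (X (n + N)) t) \<longlonglongrightarrow> (LINT t|\<nu>. t * exp (- l * t))"
  proof (rule integral_dominated_convergence[where w = "\<lambda>t. t * exp (- (l / 2) * t)"])
    show "integrable \<nu> (\<lambda>t. t * exp (- (l / 2) * t))"
      using assms by (intro integrable_mult_exp) simp
    show "AE t in \<nu>. (\<lambda>n. ?q (X (n + N)) t) \<longlonglongrightarrow> t * exp (- l * t)"
    proof (rule AE_I2)
      fix t
      have "((\<lambda>l. 1 - exp (- l * t)) has_real_derivative t * exp (- l * t)) (at l)"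
        by (auto intro!: derivative_eq_intros)
      hence "(\<lambda>h. ?q h t) \<midarrow>0\<rightarrow> t * exp (- l * t)"
        unfolding DERIV_def .
      hence "(\<lambda>n. ?q (X n) t) \<longlonglongrightarrow> t * exp (- l * t)"
        using X0 X unfolding tendsto_at_iff_sequentially comp_def by blast
      thus "(\<lambda>n. ?q (X (n + N)) t) \<longlonglongrightarrow> t * exp (- l * t)"
        by (rule LIMSEQ_ignore_initial_segment)
    qed
    show "AE t in \<nu>. norm (?q (X (n + N)) t) \<le> t * exp (- (l / 2) * t)" for n
      using AE_pos
    proof eventually_elim
      case (elim t)
      define h where "h = X (n + N)"
      have h: "h \<noteq> 0" "\<bar>h\<bar> < l / 2" using X0 N[of "n + N"] by (auto simp: h_def)
      have "\<bar>exp (- l * t) - exp (- (l + h) * t)\<bar> \<le> \<bar>- l * t - (- (l + h) * t)\<bar> * exp (- (l / 2) * t)"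
      proof (rule abs_exp_diff_le)
        show "- l * t \<le> - (l / 2) * t" using elim assms by simp
        have "l / 2 * t \<le> (l + h) * t" using elim h by (intro mult_right_mono) auto
        thus "- (l + h) * t \<le> - (l / 2) * t" by (simp only: mult_minus_left neg_le_iff_le)
      qed
      also have "- l * t - (- (l + h) * t) = h * t" by (simp add: algebra_simps)
      finally show ?case
        using h elim unfolding h_def[symmetric] by (simp add: abs_mult divide_simps mult.commute mult.left_commute)
    qed
  qed measurable
  moreover have "(LINT t|\<nu>. ?q (X (n + N)) t) =
      ((LINT t|\<nu>. 1 - exp (- (l + X (n + N)) * t)) - (LINT t|\<nu>. 1 - exp (- l * t))) / X (n + N)" for n
  proof -
    have "integrable \<nu> (\<lambda>t. 1 - exp (- (l + X (n + N)) * t))" "integrable \<nu> (\<lambda>t. 1 - exp (- l * t))"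
      using N[of "n + N"] assms by (intro integrable_one_minus_exp; linarith)+
    thus ?thesis by (simp only: integral_divide_zero Bochner_Integration.integral_diff)
  qed
  ultimately have "(\<lambda>n. ((LINT t|\<nu>. 1 - exp (- (l + X (n + N)) * t)) -
      (LINT t|\<nu>. 1 - exp (- l * t))) / X (n + N)) \<longlonglongrightarrow> (LINT t|\<nu>. t * exp (- l * t))"
    by (simp only:)
  thus "(\<lambda>n. ((LINT t|\<nu>. 1 - exp (- (l + X n) * t)) -
      (LINT t|\<nu>. 1 - exp (- l * t))) / X n) \<longlonglongrightarrow> (LINT t|\<nu>. t * exp (- l * t))"
    by (rule LIMSEQ_offset)
qed

end

section \<open>Transforms against a decreasing Levy density\<close>

text \<open>The exponent is the decay of the Gaussian kernel in dimension 3, the slowest one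
  allowed. It is integrable at infinity, and this is where \<open>3 \<le> d\<close> enters.\<close>

definition tail_kernel :: "real \<Rightarrow> real" where
  "tail_kernel s = (if 1 \<le> s then s powr (-3/2) else 0)"

lemma measurable_tail_kernel [measurable]: "tail_kernel \<in> borel_measurable borel"
  unfolding tail_kernel_def by measurable

lemma tail_kernel_nonneg: "0 \<le> tail_kernel s"
  by (simp add: tail_kernel_def)

lemma tail_kernel_le_min:
  assumes "0 < s"
  shows "\<bar>tail_kernel s\<bar> \<le> 1 * min 1 s"
proof (cases "1 \<le> s")
  case True
  hence "s powr (-3/2) \<le> s powr 0" by (intro powr_mono) auto
  with True show ?thesis by (simp add: tail_kernel_def)
qed (use assms in \<open>simp add: tail_kernel_def\<close>)

locale decreasing_levy_density = levy_measure "density_on_pos \<mu>" for \<mu> :: "real \<Rightarrow> real" +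
  assumes density_nonneg: "0 < t \<Longrightarrow> 0 \<le> \<mu> t"
    and density_decreasing: "antimono_on {0<..} \<mu>"
begin

lemma density_antimono: "0 < s \<Longrightarrow> s \<le> t \<Longrightarrow> \<mu> t \<le> \<mu> s"
  using density_decreasing by (auto simp: monotone_on_def)

text \<open>Measurability comes from monotonicity. The indicator removes the arbitrary values of
  \<mu> on the nonpositive axis.\<close>

lemma measurable_density [measurable]: "(\<lambda>t. indicator {0<..} t * \<mu> t) \<in> borel_measurable borel"
proof -
  have "mono_on {0<..} (\<lambda>t. - \<mu> t)"
    using density_antimono by (auto intro!: mono_onI)
  hence "(\<lambda>t. - \<mu> t) \<in> borel_measurable (restrict_space borel {0<..})"
    by (rule borel_measurable_mono_on_fnc)
  hence "(\<lambda>t. - (- \<mu> t)) \<in> borel_measurable (restrict_space borel {0<..})"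
    by (rule borel_measurable_uminus)
  thus ?thesis by (subst (asm) borel_measurable_restrict_space_iff) auto
qed

lemma density_on_pos_eq: "density_on_pos \<mu> = density lborel (\<lambda>t. ennreal (indicator {0<..} t * \<mu> t))"
  unfolding density_on_pos_def by (rule arg_cong[where f = "density lborel"]) (auto simp: fun_eq_iff indicator_def)

lemma indicator_density_nonneg: "0 \<le> indicator {0<..} t * \<mu> t"
  using density_nonneg by (auto simp: indicator_def)

lemma integral_density_on_pos:
  assumes [measurable]: "g \<in> borel_measurable borel"
  shows "(LINT t|density_on_pos \<mu>. g t :: real) = (LINT t:{0<..}|lborel. g t * \<mu> t)"
proof -
  have "(LINT t|density_on_pos \<mu>. g t) = (LINT t|lborel. (indicator {0<..} t * \<mu> t) *\<^sub>R g t)"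
    unfolding density_on_pos_eq
    by (rule integral_density[OF _ _ AE_I2[OF indicator_density_nonneg]]) simp_all
  also have "\<dots> = (LINT t:{0<..}|lborel. g t * \<mu> t)"
    unfolding set_lebesgue_integral_def
    by (rule Bochner_Integration.integral_cong) (simp_all only: real_scaleR_def mult.commute mult.left_commute)
  finally show ?thesis .
qed

lemma nn_integral_density_on_pos:
  assumes [measurable]: "g \<in> borel_measurable borel"
  shows "(\<integral>\<^sup>+t. g t \<partial>density_on_pos \<mu>) = (\<integral>\<^sup>+t. ennreal (indicator {0<..} t * \<mu> t) * g t \<partial>lborel)"
  unfolding density_on_pos_eq by (subst nn_integral_density) auto

text \<open>In this form the monotonicity of \<mu> can be used pointwise under a Lebesgue integral,
  with no integrability conditions on the bounding function.\<close>

lemma ennreal_integral_scaled: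
  assumes [measurable]: "f \<in> borel_measurable borel"
    and bound: "\<And>s. s > 0 \<Longrightarrow> \<bar>f s\<bar> \<le> C * min 1 s" and nonneg: "\<And>s. s > 0 \<Longrightarrow> 0 \<le> f s"
    and "0 < (l::real)"
  shows "ennreal (LINT t|density_on_pos \<mu>. f (l * t)) =
           (\<integral>\<^sup>+t. ennreal (indicator {0<..} t * \<mu> t * f (l * t)) \<partial>lborel)"
proof -
  have "ennreal (LINT t|density_on_pos \<mu>. f (l * t)) = (\<integral>\<^sup>+t. ennreal (f (l * t)) \<partial>density_on_pos \<mu>)"
  proof (rule nn_integral_eq_integral[symmetric])
    show "integrable (density_on_pos \<mu>) (\<lambda>t. f (l * t))"
      using assms by (intro integrable_scaled)
    show "AE t in density_on_pos \<mu>. 0 \<le> f (l * t)"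
      using AE_pos by eventually_elim (use assms in auto)
  qed
  also have "\<dots> = (\<integral>\<^sup>+t. ennreal (indicator {0<..} t * \<mu> t * f (l * t)) \<partial>lborel)"
    by (subst nn_integral_density_on_pos)
       (auto intro!: nn_integral_cong simp: ennreal_mult' indicator_density_nonneg)
  finally show ?thesis .
qed

text \<open>Only \<open>t\<close> between \<open>1 / (2 * l)\<close> and \<open>1 / l\<close> is
  used: there \<open>\<mu> (1 / l) \<le> \<mu> t\<close> and \<open>c \<le> f (l * t)\<close>, and
  the interval has length \<open>1 / (2 * l)\<close>.\<close>

lemma integral_scaled_ge:
  assumes [measurable]: "f \<in> borel_measurable borel"
    and bound: "\<And>s. s > 0 \<Longrightarrow> \<bar>f s\<bar> \<le> C * min 1 s" and nonneg: "\<And>s. s > 0 \<Longrightarrow> 0 \<le> f s"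
    and c: "0 \<le> c" "\<And>s. 1 / 2 \<le> s \<Longrightarrow> s \<le> 1 \<Longrightarrow> c \<le> f s"
    and l: "0 < (l::real)"
  shows "c * \<mu> (1 / l) / (2 * l) \<le> (LINT t|density_on_pos \<mu>. f (l * t))"
proof -
  have "0 \<le> (LINT t|density_on_pos \<mu>. f (l * t))"
    using AE_pos l nonneg by (intro integral_nonneg_AE) auto
  have "ennreal (c * \<mu> (1 / l) / (2 * l)) = ennreal (c * \<mu> (1 / l)) * emeasure lborel {1 / (2 * l)..1 / l}"
    using l c density_nonneg[of "1 / l"]
    by (subst emeasure_lborel_Icc) (auto simp: field_simps simp flip: ennreal_mult)
  also have "\<dots> = (\<integral>\<^sup>+t. ennreal (c * \<mu> (1 / l)) * indicator {1 / (2 * l)..1 / l} t \<partial>lborel)"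
    by (subst nn_integral_cmult_indicator) auto
  also have "\<dots> \<le> (\<integral>\<^sup>+t. ennreal (indicator {0<..} t * \<mu> t * f (l * t)) \<partial>lborel)"
  proof (rule nn_integral_mono)
    fix t :: real
    show "ennreal (c * \<mu> (1 / l)) * indicator {1 / (2 * l)..1 / l} t
        \<le> ennreal (indicator {0<..} t * \<mu> t * f (l * t))"
    proof (cases "t \<in> {1 / (2 * l)..1 / l}")
      case True
      hence t: "0 < t" "1 / 2 \<le> l * t" "l * t \<le> 1"
        using l by (auto simp: field_simps intro: less_le_trans[of 0 "1 / (2 * l)"])
      have "\<mu> (1 / l) * c \<le> \<mu> t * f (l * t)"
        using t True c density_antimono[of t "1 / l"] density_nonneg[of t]
        by (intro mult_mono) auto
      with True t show ?thesis by (auto intro!: ennreal_leI simp: mult.commute)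
    qed auto
  qed
  also have "\<dots> = ennreal (LINT t|density_on_pos \<mu>. f (l * t))"
    using assms by (intro ennreal_integral_scaled[symmetric])
  finally show ?thesis
    using \<open>0 \<le> (LINT t|density_on_pos \<mu>. f (l * t))\<close> by (simp add: ennreal_le_iff)
qed

text \<open>The kernel lives on \<open>1 / l \<le> t\<close>, where
  \<open>\<mu> t \<le> \<mu> (1 / l)\<close>; the remaining integral of
  \<open>(l * t) powr (-3/2)\<close> equals \<open>2 / l\<close>.\<close>

lemma integral_tail_kernel_le:
  assumes l: "0 < (l::real)"
  shows "(LINT t|density_on_pos \<mu>. tail_kernel (l * t)) \<le> 2 * \<mu> (1 / l) / l"
proof -
  \<comment> \<open>The antiderivative of \<open>(l * t) powr (-3/2)\<close> that vanishes at
    infinity.\<close>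
  define F where "F t = - (2 / l) * (l * t) powr (-1/2)" for t
  have "ennreal (LINT t|density_on_pos \<mu>. tail_kernel (l * t)) =
      (\<integral>\<^sup>+t. ennreal (indicator {0<..} t * \<mu> t * tail_kernel (l * t)) \<partial>lborel)"
    by (rule ennreal_integral_scaled[OF _ tail_kernel_le_min tail_kernel_nonneg l]) measurable
  also have "\<dots> \<le> (\<integral>\<^sup>+t. ennreal (\<mu> (1 / l)) * (ennreal ((l * t) powr (-3/2)) * indicator {1 / l..} t) \<partial>lborel)"
  proof (rule nn_integral_mono)
    fix t :: real
    show "ennreal (indicator {0<..} t * \<mu> t * tail_kernel (l * t))
       \<le> ennreal (\<mu> (1 / l)) * (ennreal ((l * t) powr (-3/2)) * indicator {1 / l..} t)"
    proof (cases "1 / l \<le> t")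
      case True
      hence t: "0 < t" "1 \<le> l * t"
        using l by (auto simp: field_simps intro: less_le_trans[of 0 "1 / l"])
      have "\<mu> t * (l * t) powr (-3/2) \<le> \<mu> (1 / l) * (l * t) powr (-3/2)"
        using True l density_antimono[of "1 / l" t] by (intro mult_right_mono) auto
      with True t l density_nonneg[of "1 / l"] show ?thesis
        by (auto simp: tail_kernel_def simp flip: ennreal_mult)
    next
      case False
      hence "\<not> 1 \<le> l * t" using l by (simp add: field_simps)
      thus ?thesis by (simp add: tail_kernel_def)
    qed
  qed
  also have "\<dots> = ennreal (\<mu> (1 / l)) * (\<integral>\<^sup>+t. ennreal ((l * t) powr (-3/2)) * indicator {1 / l..} t \<partial>lborel)"
    by (rule nn_integral_cmult) measurable
  also have "(\<integral>\<^sup>+t. ennreal ((l * t) powr (-3/2)) * indicator {1 / l..} t \<partial>lborel) = ennreal (0 - F (1 / l))"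
  proof (rule nn_integral_FTC_atLeast)
    show "(F \<longlongrightarrow> 0) at_top"
      unfolding F_def using l by real_asymp
    show "(F has_real_derivative (l * t) powr (-3/2)) (at t)" if "1 / l \<le> t" for t
    proof -
      have "0 < t" using that l by (auto intro: less_le_trans[of 0 "1 / l"])
      moreover from \<open>0 < t\<close> have "(l * t) powr (3/2) = (l * t) powr (1/2) * (l * t)"
        using l powr_add[of "l * t" "1/2" 1] by simp
      moreover have "(l * t) powr (1/2) * (l * t) powr (1/2) = l * t"
        using l \<open>0 < t\<close> by (simp flip: powr_add)
      ultimately show ?thesis unfolding F_def using l
        by (auto intro!: derivative_eq_intros simp: powr_diff powr_minus field_simps)
    qed
  qed auto
  also have "0 - F (1 / l) = 2 / l" using l by (simp add: F_def)
  also have "ennreal (\<mu> (1 / l)) * ennreal (2 / l) = ennreal (2 * \<mu> (1 / l) / l)"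
    using l density_nonneg[of "1 / l"] by (simp add: mult.commute flip: ennreal_mult)
  finally show ?thesis
    using l density_nonneg[of "1 / l"] by (simp add: ennreal_le_iff)
qed

text \<open>Common core of both regimes; \<open>g\<close> is the drift left in
  \<open>\<Phi>\<close>. The pairs \<open>a\<close>, \<open>m\<close> and \<open>b\<close>,
  \<open>k\<close> trade the values of \<open>f\<close> near 0 and near infinity for values at a
  dilated argument. The limits \<open>p\<close> and \<open>q\<close> make each traded term at most a
  quarter of \<open>\<Phi> l\<close>. The condition \<open>1 \<le> a * m\<close> lets a nonzero
  drift be absorbed as well.\<close>

lemma comparable_transforms:
  fixes K f \<Phi> :: "real \<Rightarrow> real"
  assumes meas [measurable]: "K \<in> borel_measurable borel" "f \<in> borel_measurable borel"
    and K_bound: "\<And>s. 0 < s \<Longrightarrow> \<bar>K s\<bar> \<le> C\<^sub>K * min 1 s"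
    and f_bound: "\<And>s. 0 < s \<Longrightarrow> \<bar>f s\<bar> \<le> C\<^sub>f * min 1 s"
    and pos: "\<And>s. 0 < s \<Longrightarrow> 0 < K s" "\<And>s. 0 < s \<Longrightarrow> 0 < f s"
    and cont: "continuous_on {0<..} K" "continuous_on {0<..} f"
    and K_le_f: "\<And>s. 0 < s \<Longrightarrow> s \<le> 1 \<Longrightarrow> K s \<le> A * f s" and A: "0 < A"
    and K_le_tail: "\<And>s. 1 \<le> s \<Longrightarrow> K s \<le> s powr (-3/2)"
    and near_0: "\<And>s. 0 < s \<Longrightarrow> s < \<epsilon> \<Longrightarrow> f s \<le> a * f (m * s)"
      "0 < \<epsilon>" "0 < m" "0 \<le> a"
    and near_infinity: "\<And>s. N < s \<Longrightarrow> f s \<le> b * f (k * s)" "0 < k" "0 \<le> b"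
    and g: "0 \<le> g" "g = 0 \<or> 1 \<le> a * m"
    and \<Phi>: "\<And>l. 0 < l \<Longrightarrow> \<Phi> l = g * l + (LINT t|density_on_pos \<mu>. f (l * t))"
    and lim_m: "((\<lambda>l. \<Phi> (m * l) / \<Phi> l) \<longlongrightarrow> p) at_top" "a * p < 1 / 4"
    and lim_k: "((\<lambda>l. \<Phi> (k * l) / \<Phi> l) \<longlongrightarrow> q) at_top" "b * q < 1 / 4"
    and t0: "0 < t\<^sub>0" "0 < \<mu> t\<^sub>0"
  shows "\<exists>c>0. \<exists>C>0. eventually (\<lambda>l.
           c \<le> (LINT t|density_on_pos \<mu>. K (l * t)) / \<Phi> l \<and>
           (LINT t|density_on_pos \<mu>. K (l * t)) / \<Phi> l \<le> C) at_top"
proof -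
  define I where "I l = (LINT t|density_on_pos \<mu>. f (l * t))" for l
  define J where "J l = (LINT t|density_on_pos \<mu>. K (l * t))" for l
  note int_f = integrable_scaled[OF meas(2) f_bound]
  note int_K = integrable_scaled[OF meas(1) K_bound]
  note int_tail = integrable_scaled[OF measurable_tail_kernel tail_kernel_le_min]
  have I_nonneg: "0 \<le> I l" and J_nonneg: "0 \<le> J l" if "0 < l" for l
    unfolding I_def J_def using AE_pos that pos
    by (intro integral_nonneg_AE; force intro: less_imp_le elim: eventually_mono)+

  obtain c0 where c0: "0 < c0" "\<And>s. 1 / 2 \<le> s \<Longrightarrow> s \<le> 1 \<Longrightarrow> c0 \<le> f s"
  proof -
    have "continuous_on {1/2..1} f" by (rule continuous_on_subset[OF cont(2)]) auto
    then obtain x where "x \<in> {1/2..1}" "\<And>y. y \<in> {1/2..1} \<Longrightarrow> f x \<le> f y"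
      using continuous_attains_inf[of "{1/2..1::real}" f] by auto
    thus ?thesis using pos(2)[of x] by (intro that[of "f x"]) auto
  qed
  have I_ge: "c0 * \<mu> (1 / l) / (2 * l) \<le> I l" if "0 < l" for l
    unfolding I_def using c0 that pos(2) f_bound
    by (intro integral_scaled_ge[of f C\<^sub>f]) (auto intro: less_imp_le)

  \<comment> \<open>\<open>D\<close> is the maximum of \<open>f / K\<close> on a compact interval.
    The right end is \<open>max \<epsilon> N\<close>, so that the interval is nonempty even if
    \<open>N < \<epsilon>\<close>.\<close>
  obtain D where D: "0 < D" "\<And>s. \<epsilon> \<le> s \<Longrightarrow> s \<le> N \<Longrightarrow> f s \<le> D * K s"
  proof -
    have "\<forall>s\<in>{\<epsilon>..max \<epsilon> N}. K s \<noteq> 0"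
    proof
      fix s assume "s \<in> {\<epsilon>..max \<epsilon> N}"
      hence "0 < s" using near_0(2) by auto
      thus "K s \<noteq> 0" using pos(1)[of s] by simp
    qed
    hence "continuous_on {\<epsilon>..max \<epsilon> N} (\<lambda>s. f s / K s)"
      using near_0(2)
      by (intro continuous_intros continuous_on_subset[OF cont(1)] continuous_on_subset[OF cont(2)])
         force+
    then obtain x where x: "x \<in> {\<epsilon>..max \<epsilon> N}"
        and le: "\<And>y. y \<in> {\<epsilon>..max \<epsilon> N} \<Longrightarrow> f y / K y \<le> f x / K x"
      using continuous_attains_sup[of "{\<epsilon>..max \<epsilon> N}" "\<lambda>s. f s / K s"] by auto
    show ?thesis
    proof (rule that[of "f x / K x"])
      show "0 < f x / K x" using x near_0(2) pos by auto
      show "f s \<le> f x / K x * K s" if "\<epsilon> \<le> s" "s \<le> N" for s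
        using le[of s] that near_0(2) pos(1)[of s] by (simp add: pos_divide_le_eq)
    qed
  qed

  have upper: "J l \<le> (A + 4 / c0) * \<Phi> l" if l: "0 < l" for l
  proof -
    have "J l \<le> (LINT t|density_on_pos \<mu>. A * f (l * t) + tail_kernel (l * t))"
      unfolding J_def
    proof (rule integral_mono_AE)
      show "AE t in density_on_pos \<mu>. K (l * t) \<le> A * f (l * t) + tail_kernel (l * t)"
        using AE_pos
      proof eventually_elim
        case (elim t)
        thus ?case
          using K_le_f[of "l * t"] K_le_tail[of "l * t"] l A pos(2)[of "l * t"]
          by (auto simp: tail_kernel_def intro: add_increasing)
      qed
    qed (use l in \<open>auto intro!: Bochner_Integration.integrable_add integrable_mult_right int_f int_K int_tail\<close>)
    also have "\<dots> = A * I l + (LINT t|density_on_pos \<mu>. tail_kernel (l * t))"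
      unfolding I_def using l int_f int_tail by simp
    also have "\<dots> \<le> A * I l + 2 * \<mu> (1 / l) / l"
      using integral_tail_kernel_le[OF l] by simp
    \<comment> \<open>The factor \<open>4 / c0\<close> is exactly what turns the lower bound
      \<open>I_ge\<close> into \<open>2 * \<mu> (1 / l) / l\<close>.\<close>
    also have "2 * \<mu> (1 / l) / l \<le> 4 / c0 * I l"
      using I_ge[OF l] c0(1) l by (simp add: field_simps)
    also have "A * I l + 4 / c0 * I l = (A + 4 / c0) * I l" by (simp add: algebra_simps)
    also have "\<dots> \<le> (A + 4 / c0) * \<Phi> l"
      using A c0(1) l g(1) by (intro mult_left_mono) (auto simp: \<Phi> I_def)
    finally show ?thesis by simp
  qed

  have lower: "\<Phi> l \<le> D * J l + a * \<Phi> (m * l) + b * \<Phi> (k * l)" if l: "0 < l" for l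
  proof -
    have "I l \<le> (LINT t|density_on_pos \<mu>. D * K (l * t) + a * f ((m * l) * t) + b * f ((k * l) * t))"
      unfolding I_def
    proof (rule integral_mono_AE)
      show "AE t in density_on_pos \<mu>. f (l * t)
          \<le> D * K (l * t) + a * f ((m * l) * t) + b * f ((k * l) * t)"
        using AE_pos
      proof eventually_elim
        case (elim t)
        define s where "s = l * t"
        have s: "0 < s" using elim l by (simp add: s_def)
        have nonneg: "0 \<le> D * K s" "0 \<le> a * f (m * s)" "0 \<le> b * f (k * s)"
          using D(1) near_0(3,4) near_infinity(2,3) s pos(1)[of s] pos(2)[of "m * s"] pos(2)[of "k * s"]
          by simp_all
        have "f s \<le> D * K s + a * f (m * s) + b * f (k * s)"
        proof -
          consider "s < \<epsilon>" | "N < s" | "\<epsilon> \<le> s" "s \<le> N" by linarith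
          thus ?thesis
          proof cases
            case 1
            from near_0(1)[OF s this] nonneg show ?thesis by linarith
          next
            case 2
            from near_infinity(1)[OF this] nonneg show ?thesis by linarith
          next
            case 3
            from D(2)[OF this] nonneg show ?thesis by linarith
          qed
        qed
        thus ?case by (simp only: s_def mult.assoc)
      qed
    qed (use l near_0(3) near_infinity(2) in
         \<open>auto intro!: Bochner_Integration.integrable_add integrable_mult_right int_f int_K\<close>)
    also have "\<dots> = D * J l + a * I (m * l) + b * I (k * l)"
      unfolding I_def J_def using l near_0(3) near_infinity(2) int_f int_K by simp
    finally have "I l \<le> D * J l + a * I (m * l) + b * I (k * l)" .
    \<comment> \<open>The drift of \<open>\<Phi> l\<close> is covered by the drift contained in
      \<open>a * \<Phi> (m * l)\<close>.\<close>
    moreover have "g * l \<le> (a * m) * (g * l)"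
      using g l mult_right_mono[of 1 "a * m" "g * l"] by auto
    moreover have "0 \<le> b * (g * (k * l))"
      using g(1) l near_infinity(2,3) by simp
    ultimately show ?thesis
      using l near_0(3) near_infinity(2) by (simp add: \<Phi> I_def algebra_simps)
  qed

  have "eventually (\<lambda>l. a * (\<Phi> (m * l) / \<Phi> l) < 1 / 4) at_top"
    by (rule order_tendstoD(2)[OF tendsto_mult_left[OF lim_m(1)] lim_m(2)])
  moreover have "eventually (\<lambda>l. b * (\<Phi> (k * l) / \<Phi> l) < 1 / 4) at_top"
    by (rule order_tendstoD(2)[OF tendsto_mult_left[OF lim_k(1)] lim_k(2)])
  \<comment> \<open>From here on \<open>1 / l\<close> lies to the left of a point where \<mu> is
    positive, so \<open>\<mu> (1 / l)\<close> and hence \<open>\<Phi> l\<close> are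
    positive.\<close>
  moreover have "eventually (\<lambda>l. 1 / t\<^sub>0 \<le> l) at_top" by (rule eventually_ge_at_top)
  ultimately have "eventually (\<lambda>l. 1 / (2 * D) \<le> J l / \<Phi> l \<and> J l / \<Phi> l \<le> A + 4 / c0) at_top"
  proof eventually_elim
    case (elim l)
    have l: "0 < l" using elim(3) t0(1) by (auto intro: less_le_trans[of 0 "1 / t\<^sub>0"])
    hence "1 / l \<le> t\<^sub>0" using elim(3) t0(1) by (simp add: field_simps)
    hence "0 < \<mu> (1 / l)" using density_antimono[of "1 / l" t\<^sub>0] t0 l by simp
    hence "0 < c0 * \<mu> (1 / l) / (2 * l)" using c0 l by simp
    hence pos: "0 < \<Phi> l" using I_ge[OF l] g(1) l by (simp add: \<Phi> I_def add_nonneg_pos)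
    hence "a * \<Phi> (m * l) \<le> \<Phi> l / 4" "b * \<Phi> (k * l) \<le> \<Phi> l / 4"
      using elim(1,2) by (simp_all add: field_simps)
    \<comment> \<open>Two quarters of \<open>\<Phi> l\<close> move to the left side of
      \<open>lower\<close>, leaving one half.\<close>
    hence "\<Phi> l \<le> 2 * (D * J l)" using lower[OF l] by linarith
    hence "1 / (2 * D) \<le> J l / \<Phi> l"
      using pos D(1) by (simp add: pos_le_divide_eq pos_divide_le_eq mult_ac)
    moreover have "J l / \<Phi> l \<le> A + 4 / c0"
      using upper[OF l] pos by (simp only: pos_divide_le_eq)
    ultimately show ?case by blast
  qed
  moreover have "0 < 1 / (2 * D)" "0 < A + 4 / c0" using D(1) A c0(1) by (simp_all add: add_pos_pos)
  ultimately show ?thesis unfolding J_def by blast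
qed

end

section \<open>The Gaussian kernel as a function of time\<close>

text \<open>This is the heat kernel at time \<open>s\<close> and distance 1, without the factor
  \<open>(4 * pi) powr (- d / 2)\<close>.\<close>

definition gauss_profile :: "nat \<Rightarrow> real \<Rightarrow> real" where
  "gauss_profile d s = s powr (- real d / 2) * exp (- 1 / (4 * s))"

lemma measurable_gauss_profile [measurable]: "gauss_profile d \<in> borel_measurable borel"
  unfolding gauss_profile_def by measurable

lemma gauss_profile_pos: "0 < s \<Longrightarrow> 0 < gauss_profile d s"
  by (simp add: gauss_profile_def)

lemma continuous_on_gauss_profile: "continuous_on {0<..} (gauss_profile d)"
  unfolding gauss_profile_def by (intro continuous_intros) auto

lemma gauss_profile_le_tail:
  assumes "3 \<le> d" "1 \<le> s"
  shows "gauss_profile d s \<le> s powr (-3/2)"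
proof -
  have "gauss_profile d s \<le> s powr (- real d / 2) * 1"
    unfolding gauss_profile_def using assms by (intro mult_left_mono) auto
  also have "\<dots> \<le> s powr (-3/2)"
    using assms by (simp add: powr_mono)
  finally show ?thesis .
qed

text \<open>The exponential beats every power: \<open>x ^ n \<le> exp (n * x)\<close> at
  \<open>x = 1 / (4 * n * s)\<close>. The choice \<open>n = d + 2\<close> ensures
  \<open>n - d / 2 \<ge> 2\<close>. The second order is what the comparison with
  \<open>gamma2_cdf\<close> requires.\<close>

lemma gauss_profile_le_square:
  assumes s: "0 < s" "s \<le> 1"
  shows "gauss_profile d s \<le> (4 * real (d + 2)) ^ (d + 2) * s\<^sup>2"
proof -
  define n where "n = d + 2"
  define x where "x = 1 / (4 * real n * s)"
  have "x > 0" using s by (simp add: x_def n_def)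
  hence "x ^ n \<le> exp x ^ n"
    using exp_ge_add_one_self[of x] by (intro power_mono) linarith+
  also have "exp x ^ n = exp (1 / (4 * s))"
  proof -
    have "real n * x = 1 / (4 * s)" using s by (simp add: x_def n_def divide_simps)
    thus ?thesis by (simp flip: exp_of_nat_mult)
  qed
  finally have "exp (- 1 / (4 * s)) \<le> 1 / x ^ n"
    using \<open>x > 0\<close> by (simp add: exp_minus field_simps)
  also have "1 / x ^ n = (4 * real n) ^ n * s ^ n"
    by (simp add: x_def power_mult_distrib power_one_over)
  finally have "gauss_profile d s \<le> s powr (- real d / 2) * ((4 * real n) ^ n * s powr real n)"
    unfolding gauss_profile_def using s by (intro mult_left_mono) (auto simp: powr_realpow)
  also have "\<dots> = (4 * real n) ^ n * s powr (real n - real d / 2)"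
    using s by (simp add: powr_add[symmetric] algebra_simps)
  also have "s powr (real n - real d / 2) \<le> s powr (real 2)"
    using s by (intro powr_mono') (auto simp: n_def)
  also have "s powr (real 2) = s\<^sup>2" using s by (intro powr_realpow)
  finally show ?thesis by (simp add: n_def mult_left_mono)
qed

lemma gauss_profile_le_min:
  assumes "3 \<le> d" "0 < s"
  shows "\<bar>gauss_profile d s\<bar> \<le> (4 * real (d + 2)) ^ (d + 2) * min 1 s"
proof (cases "s \<le> 1")
  case True
  have "gauss_profile d s \<le> (4 * real (d + 2)) ^ (d + 2) * s\<^sup>2"
    using assms True by (intro gauss_profile_le_square)
  also have "\<dots> \<le> (4 * real (d + 2)) ^ (d + 2) * s"
    using assms True by (intro mult_left_mono) (auto simp: power2_eq_square mult_left_le)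
  finally show ?thesis using True gauss_profile_pos[OF assms(2), of d] by simp
next
  case False
  have "gauss_profile d s \<le> s powr (-3/2)"
    using assms False by (intro gauss_profile_le_tail) auto
  also have "\<dots> \<le> s powr 0" using False by (intro powr_mono) auto
  also have "s powr 0 = 1" using False by simp
  also have "1 \<le> (4 * real (d + 2)) ^ (d + 2)" by (rule one_le_power) simp
  finally show ?thesis using False gauss_profile_pos[OF assms(2), of d] by simp
qed

section \<open>The kernel of the borderline index 2\<close>

text \<open>The distribution function of the Gamma law with shape 2 and rate 1. Its transform
  against the Levy measure is \<open>\<phi> l - l * deriv \<phi> l\<close>, in which the drift
  cancels.\<close>

definition gamma2_cdf :: "real \<Rightarrow> real" where
  "gamma2_cdf s = 1 - exp (- s) - s * exp (- s)"

lemma DERIV_gamma2_cdf: "(gamma2_cdf has_real_derivative s * exp (- s)) (at s)"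
  unfolding gamma2_cdf_def[abs_def] by (auto intro!: derivative_eq_intros)

lemma measurable_gamma2_cdf [measurable]: "gamma2_cdf \<in> borel_measurable borel"
  unfolding gamma2_cdf_def by measurable

lemma gamma2_cdf_mono:
  assumes "0 \<le> s" "s \<le> t"
  shows "gamma2_cdf s \<le> gamma2_cdf t"
  using assms by (intro DERIV_nonneg_imp_nondecreasing[OF assms(2)])
    (auto intro!: exI[of _ "_ * exp (- _)"] DERIV_gamma2_cdf)

text \<open>The derivative \<open>s * exp (- s)\<close> is at most \<open>s\<close>, and both sides
  vanish at 0.\<close>

lemma gamma2_cdf_le_square:
  assumes "0 \<le> s"
  shows "gamma2_cdf s \<le> s\<^sup>2 / 2"
proof -
  have "0\<^sup>2 / 2 - gamma2_cdf 0 \<le> s\<^sup>2 / 2 - gamma2_cdf s"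
  proof (rule DERIV_nonneg_imp_nondecreasing[OF assms])
    fix x :: real assume x: "0 \<le> x"
    have "((\<lambda>s. s\<^sup>2 / 2 - gamma2_cdf s) has_real_derivative x - x * exp (- x)) (at x)"
      by (auto intro!: derivative_eq_intros DERIV_gamma2_cdf)
    moreover have "0 \<le> x - x * exp (- x)" using x by (simp add: mult_left_le)
    ultimately show "\<exists>y. ((\<lambda>s. s\<^sup>2 / 2 - gamma2_cdf s) has_real_derivative y) (at x) \<and> 0 \<le> y"
      by blast
  qed
  thus ?thesis by (simp add: gamma2_cdf_def)
qed

text \<open>On the unit interval the derivative \<open>s * exp (- s)\<close> is at least
  \<open>s * exp (- 1)\<close>. Together with the upper bound this gives exact order 2 at 0.\<close>

lemma gamma2_cdf_ge_square:
  assumes "0 \<le> s" "s \<le> 1"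
  shows "s\<^sup>2 / (2 * exp 1) \<le> gamma2_cdf s"
proof -
  have "gamma2_cdf 0 - 0\<^sup>2 / (2 * exp 1) \<le> gamma2_cdf s - s\<^sup>2 / (2 * exp 1)"
  proof (rule DERIV_nonneg_imp_nondecreasing[OF assms(1)])
    fix x :: real assume x: "0 \<le> x" "x \<le> s"
    have "((\<lambda>s. gamma2_cdf s - s\<^sup>2 / (2 * exp 1)) has_real_derivative x * exp (- x) - x * exp (- 1)) (at x)"
      by (auto intro!: derivative_eq_intros DERIV_gamma2_cdf simp: exp_minus field_simps)
    moreover have "0 \<le> x * exp (- x) - x * exp (- 1)" using x assms by (simp add: mult_left_mono)
    ultimately show "\<exists>y. ((\<lambda>s. gamma2_cdf s - s\<^sup>2 / (2 * exp 1)) has_real_derivative y) (at x) \<and> 0 \<le> y"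
      by blast
  qed
  thus ?thesis by (simp add: gamma2_cdf_def)
qed

lemma gamma2_cdf_pos:
  assumes "0 < s"
  shows "0 < gamma2_cdf s"
proof -
  have "0 < (min s 1)\<^sup>2 / (2 * exp 1)" using assms by simp
  also have "\<dots> \<le> gamma2_cdf (min s 1)" using assms by (intro gamma2_cdf_ge_square) auto
  also have "\<dots> \<le> gamma2_cdf s" using assms by (intro gamma2_cdf_mono) auto
  finally show ?thesis .
qed

lemma gamma2_cdf_le_min:
  assumes "0 < s"
  shows "\<bar>gamma2_cdf s\<bar> \<le> 1 * min 1 s"
proof -
  have "gamma2_cdf s \<le> 1 - exp (- s)" using assms by (simp add: gamma2_cdf_def)
  moreover have "1 - exp (- s) \<le> s" using exp_ge_add_one_self[of "- s"] by linarith
  moreover from calculation have "gamma2_cdf s \<le> 1" using exp_gt_zero[of "- s"] by linarith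
  ultimately show ?thesis using gamma2_cdf_pos[OF assms] by auto
qed

text \<open>By monotonicity the value at 1 decides, and it is at least
  \<open>1 / (2 * exp 1)\<close>; the 6 comes from \<open>exp 1 \<le> 3\<close>.\<close>

lemma one_le_gamma2_cdf:
  assumes "1 \<le> s"
  shows "1 \<le> 6 * gamma2_cdf s"
proof -
  have "1 / 6 \<le> 1 / (2 * exp (1::real))" using exp_le by (simp add: field_simps)
  also have "\<dots> \<le> gamma2_cdf 1" using gamma2_cdf_ge_square[of 1] by simp
  also have "\<dots> \<le> gamma2_cdf s" using assms by (intro gamma2_cdf_mono) auto
  finally show ?thesis by simp
qed

section \<open>The Laplace exponent, its derivative and its growth\<close>

locale laplace_exponent = decreasing_levy_density +
  fixes \<gamma> :: real and \<phi> :: "real \<Rightarrow> real"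
  assumes drift_nonneg: "0 \<le> \<gamma>"
    and exponent: "0 < l \<Longrightarrow> \<phi> l = \<gamma> * l + (LINT t|density_on_pos \<mu>. 1 - exp (- l * t))"
    and infinite_levy: "emeasure (density_on_pos \<mu>) {0<..} = \<infinity>"
begin

lemma DERIV_exponent:
  assumes "0 < l"
  shows "(\<phi> has_real_derivative \<gamma> + (LINT t|density_on_pos \<mu>. t * exp (- l * t))) (at l)"
proof -
  have "((\<lambda>l. \<gamma> * l + (LINT t|density_on_pos \<mu>. 1 - exp (- l * t))) has_real_derivative
      \<gamma> + (LINT t|density_on_pos \<mu>. t * exp (- l * t))) (at l)"
    using DERIV_add[OF DERIV_cmult_Id DERIV_laplace[OF assms]] .
  moreover have "eventually (\<lambda>l. l \<in> {0<..}) (nhds l)"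
    using assms by (intro eventually_nhds_in_open) auto
  hence "eventually (\<lambda>l. \<phi> l = \<gamma> * l + (LINT t|density_on_pos \<mu>. 1 - exp (- l * t))) (nhds l)"
    by eventually_elim (rule exponent, simp)
  ultimately show ?thesis by (subst DERIV_cong_ev[OF refl _ refl])
qed

lemma deriv_exponent:
  "0 < l \<Longrightarrow> deriv \<phi> l = \<gamma> + (LINT t|density_on_pos \<mu>. t * exp (- l * t))"
  by (rule DERIV_imp_deriv[OF DERIV_exponent])

lemma has_real_derivative_exponent: "0 < l \<Longrightarrow> (\<phi> has_real_derivative deriv \<phi> l) (at l)"
  using DERIV_exponent deriv_exponent by simp

lemma ex_density_pos: "\<exists>t>0. 0 < \<mu> t"
proof (rule ccontr)
  assume "\<not> (\<exists>t>0. 0 < \<mu> t)"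
  hence "indicator {0<..} t * \<mu> t = 0" for t
    using density_nonneg[of t] by (auto simp: indicator_def not_less intro: antisym)
  hence "density_on_pos \<mu> = density lborel (\<lambda>_. 0)"
    unfolding density_on_pos_eq by (simp only: ennreal_0)
  hence "emeasure (density_on_pos \<mu>) {0<..} = 0" by (simp add: emeasure_density)
  with infinite_levy show False by simp
qed

text \<open>Since the Levy measure is infinite, some half line from \<open>1 / Suc n\<close> has
  mass above \<open>2 * Z\<close>. For \<open>l \<ge> Suc n\<close> the integrand is at least
  \<open>1 / 2\<close> on it. The divergence serves l'Hopital's rule and gives eventual positivity
  of \<phi>.\<close>

lemma exponent_at_top: "filterlim \<phi> at_top at_top"
  unfolding filterlim_at_top
proof
  fix Z :: real
  let ?\<nu> = "density_on_pos \<mu>"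
  let ?A = "\<lambda>n. {1 / real (Suc n)..}"
  have "(\<lambda>n. emeasure ?\<nu> (?A n)) \<longlonglongrightarrow> emeasure ?\<nu> (\<Union>n. ?A n)"
  proof (rule Lim_emeasure_incseq)
    show "range ?A \<subseteq> sets ?\<nu>" by (auto simp: sets_levy)
    show "incseq ?A" by (auto intro!: incseq_SucI frac_le elim: order_trans[rotated])
  qed
  also have "(\<Union>n. ?A n) = {0<..}"
  proof safe
    fix t :: real assume "0 < t"
    then obtain n where "inverse (real (Suc n)) < t" using reals_Archimedean by blast
    thus "t \<in> (\<Union>n. ?A n)" by (auto simp: inverse_eq_divide intro!: exI[of _ n])
  qed (auto intro: less_le_trans[of 0 "1 / real (Suc _)"])
  \<comment> \<open>Doubling compensates the later factor \<open>1 / 2\<close>;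
    \<open>max Z 0\<close> keeps the number faithful under \<open>ennreal\<close>.\<close>
  finally have "eventually (\<lambda>n. ennreal (2 * max Z 0) < emeasure ?\<nu> (?A n)) sequentially"
    unfolding infinite_levy by (rule order_tendstoD) simp
  then obtain n where n: "ennreal (2 * max Z 0) < emeasure ?\<nu> (?A n)"
    by (auto simp: eventually_sequentially)
  have "eventually (\<lambda>l. real (Suc n) \<le> l) at_top" by (rule eventually_ge_at_top)
  thus "eventually (\<lambda>l. Z \<le> \<phi> l) at_top"
  proof eventually_elim
    case (elim l)
    hence l: "0 < l" by (auto intro: less_le_trans[of 0 "real (Suc n)"])
    have nonneg: "AE t in ?\<nu>. 0 \<le> 1 - exp (- l * t)"
      using AE_pos by eventually_elim (use l in auto)
    have "ennreal (max Z 0) = ennreal (1 / 2 * (2 * max Z 0))" by simp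
    also have "\<dots> = ennreal (1 / 2) * ennreal (2 * max Z 0)" by (rule ennreal_mult) auto
    also have "\<dots> \<le> ennreal (1 / 2) * emeasure ?\<nu> (?A n)"
      using n by (intro mult_left_mono) auto
    also have "\<dots> = (\<integral>\<^sup>+t. ennreal (1 / 2) * indicator (?A n) t \<partial>?\<nu>)"
      by (rule nn_integral_cmult_indicator[symmetric]) (simp add: sets_levy)
    also have "\<dots> \<le> (\<integral>\<^sup>+t. ennreal (1 - exp (- l * t)) \<partial>?\<nu>)"
    proof (rule nn_integral_mono)
      fix t
      show "ennreal (1 / 2) * indicator (?A n) t \<le> ennreal (1 - exp (- l * t))"
      proof (cases "t \<in> ?A n")
        case True
        hence "real (Suc n) * (1 / real (Suc n)) \<le> l * t" using elim by (intro mult_mono) auto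
        hence "1 \<le> l * t" by simp
        hence "2 \<le> exp (l * t)" using exp_ge_add_one_self[of "l * t"] by linarith
        hence "1 / 2 \<le> 1 - exp (- l * t)" by (simp add: exp_minus field_simps)
        hence "ennreal (1 / 2) \<le> ennreal (1 - exp (- l * t))" by (rule ennreal_leI)
        thus ?thesis unfolding indicator_simps(1)[OF True] mult_1_right .
      qed auto
    qed
    also have "\<dots> = ennreal (LINT t|?\<nu>. 1 - exp (- l * t))"
      using l nonneg by (intro nn_integral_eq_integral integrable_one_minus_exp)
    finally have "max Z 0 \<le> (LINT t|?\<nu>. 1 - exp (- l * t))"
      using integral_nonneg_AE[OF nonneg] by (simp only: ennreal_le_iff)
    moreover have "0 \<le> \<gamma> * l" using l drift_nonneg by simp
    ultimately show ?case using l by (simp add: exponent)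
  qed
qed

section \<open>The two regimes of regular variation\<close>

text \<open>Here \<open>l * deriv \<phi> l\<close> has index \<open>\<alpha> / 2 < 1\<close>, while
  \<open>s * exp (- s)\<close> vanishes to order 1 at 0. Dilating by a large \<open>m\<close>
  therefore gains a factor of order \<open>1 / m\<close> against growth by only
  \<open>m powr (\<alpha> / 2)\<close>.\<close>

lemma comparable_case_less:
  assumes d: "3 \<le> d" and \<alpha>: "\<alpha> < 2"
    and lim: "\<And>x. x > 0 \<Longrightarrow>
      ((\<lambda>l. deriv \<phi> (l * x) / deriv \<phi> l) \<longlongrightarrow> x powr (\<alpha> / 2 - 1)) at_top"
    and "0 \<le> \<alpha>"
  shows "\<exists>c>0. \<exists>C>0. eventually (\<lambda>l.
           c \<le> (LINT t|density_on_pos \<mu>. gauss_profile d (l * t)) / (l * deriv \<phi> l) \<and>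
           (LINT t|density_on_pos \<mu>. gauss_profile d (l * t)) / (l * deriv \<phi> l) \<le> C) at_top"
proof -
  obtain t0 where t0: "0 < t0" "0 < \<mu> t0" using ex_density_pos by auto
  \<comment> \<open>Chosen so that \<open>m powr (\<alpha> / 2 - 1) = 1 / 16\<close>, which is
    possible because \<open>\<alpha> < 2\<close>.\<close>
  define m :: real where "m = 16 powr (1 / (1 - \<alpha> / 2))"
  define A where "A = (4 * real (d + 2)) ^ (d + 2) * exp 1"
  have m: "0 < m" by (simp add: m_def)
  have "m powr (\<alpha> / 2 - 1) = 16 powr (1 / (1 - \<alpha> / 2) * (\<alpha> / 2 - 1))"
    by (simp add: m_def powr_powr)
  also have "1 / (1 - \<alpha> / 2) * (\<alpha> / 2 - 1) = - 1" using \<alpha> by (simp add: field_simps)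
  finally have m_powr: "m powr (\<alpha> / 2 - 1) = 1 / 16" by (simp add: powr_minus)
  have ratio: "((\<lambda>l. ((x * l) * deriv \<phi> (x * l)) / (l * deriv \<phi> l)) \<longlongrightarrow> x * x powr (\<alpha> / 2 - 1)) at_top"
    if "0 < x" for x
  proof (rule Lim_transform_eventually)
    show "((\<lambda>l. x * (deriv \<phi> (l * x) / deriv \<phi> l)) \<longlongrightarrow> x * x powr (\<alpha> / 2 - 1)) at_top"
      by (intro tendsto_mult_left lim that)
    show "eventually (\<lambda>l. x * (deriv \<phi> (l * x) / deriv \<phi> l) = (x * l) * deriv \<phi> (x * l) / (l * deriv \<phi> l)) at_top"
      using eventually_gt_at_top[of "0::real"] by eventually_elim (auto simp: mult.commute)
  qed
  show ?thesis
  \<comment> \<open>With these constants \<open>a * m = exp 1\<close> is at least 1, as the drift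
    requires, and \<open>a * p = exp 1 / 16 < 1 / 4\<close>. At infinity \<open>q \<le> 1\<close>,
    so \<open>b * q \<le> 1 / 8\<close>.\<close>
  proof (rule comparable_transforms[where f = "\<lambda>s. s * exp (- s)" and \<Phi> = "\<lambda>l. l * deriv \<phi> l"
        and a = "exp 1 / m" and b = "1 / 8" and m = m and k = "1 / 2" and \<epsilon> = "1 / m" and N = 32
        and A = A and g = \<gamma>, OF _ _ gauss_profile_le_min[OF d] _ gauss_profile_pos _
        continuous_on_gauss_profile])
    show "gauss_profile d s \<le> s powr (-3/2)" if "1 \<le> s" for s
      using d that by (rule gauss_profile_le_tail)
    show "\<bar>s * exp (- s)\<bar> \<le> 1 * min 1 s" if "0 < s" for s :: real
      using mult_exp_neg_le_min[OF that] by simp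
    show "gauss_profile d s \<le> A * (s * exp (- s))" if s: "0 < s" "s \<le> 1" for s
    proof -
      have "gauss_profile d s \<le> (4 * real (d + 2)) ^ (d + 2) * s\<^sup>2"
        using s by (rule gauss_profile_le_square)
      moreover have "s * s \<le> s * exp (1 - s)"
        using s exp_ge_add_one_self[of "1 - s"] by (intro mult_left_mono) linarith+
      hence "s\<^sup>2 \<le> exp 1 * (s * exp (- s))"
        by (simp add: power2_eq_square exp_diff exp_minus field_simps)
      ultimately show ?thesis
        unfolding A_def mult.assoc by (auto elim!: order_trans intro!: mult_left_mono)
    qed
    show "s * exp (- s) \<le> exp 1 / m * (m * s * exp (- (m * s)))" if s: "0 < s" "s < 1 / m" for s
    proof -
      have "m * s \<le> 1" using s m by (simp add: field_simps)
      hence "s * exp (- s) \<le> s * exp (1 - m * s)" using s by (intro mult_left_mono) auto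
      also have "\<dots> = exp 1 / m * (m * s * exp (- (m * s)))"
        using m by (simp add: exp_diff exp_minus field_simps)
      finally show ?thesis .
    qed
    show "s * exp (- s) \<le> 1 / 8 * (1 / 2 * s * exp (- (1 / 2 * s)))" if s: "32 < s" for s :: real
    proof -
      \<comment> \<open>The threshold 32 makes \<open>1 + s / 2\<close> exceed 16; halving the
        argument then costs a factor 2 and leaves \<open>b = 1 / 8\<close>.\<close>
      have "16 \<le> exp (s / 2)" using exp_ge_add_one_self[of "s / 2"] s by linarith
      hence "s * 16 * exp (- s) \<le> s * exp (s / 2) * exp (- s)"
        using s by (intro mult_left_mono mult_right_mono) auto
      also have "\<dots> = s * exp (- (s / 2))" by (simp add: mult.assoc flip: exp_add)
      finally show ?thesis by simp
    qed
    show "l * deriv \<phi> l = \<gamma> * l + (LINT t|density_on_pos \<mu>. l * t * exp (- (l * t)))" if "0 < l" for l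
      using that by (simp add: deriv_exponent algebra_simps flip: integral_mult_right_zero)
    show "((\<lambda>l. (m * l) * deriv \<phi> (m * l) / (l * deriv \<phi> l)) \<longlongrightarrow> m * m powr (\<alpha> / 2 - 1)) at_top"
      by (rule ratio[OF m])
    show "exp 1 / m * (m * m powr (\<alpha> / 2 - 1)) < 1 / 4"
      using m exp_le by (simp add: m_powr)
    show "((\<lambda>l. (1 / 2 * l) * deriv \<phi> (1 / 2 * l) / (l * deriv \<phi> l)) \<longlongrightarrow>
        1 / 2 * (1 / 2) powr (\<alpha> / 2 - 1)) at_top"
      by (rule ratio) simp
    have "(1 / 2 :: real) powr (\<alpha> / 2 - 1) \<le> (1 / 2) powr (- 1)"
      using \<open>0 \<le> \<alpha>\<close> by (intro powr_mono') auto
    thus "1 / 8 * (1 / 2 * (1 / 2) powr (\<alpha> / 2 - 1)) < (1 / 4 :: real)"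
      by (simp add: powr_minus)
  qed (use m t0 d drift_nonneg in \<open>auto simp: A_def intro!: continuous_intros\<close>)
qed

text \<open>For index 1 the linear kernel \<open>s * exp (- s)\<close> gains nothing under dilation.
  The kernel \<open>gamma2_cdf\<close> vanishes quadratically while its transform still has index 1,
  so a large dilation gains again.\<close>

lemma comparable_case_two:
  assumes d: "3 \<le> d"
    and lim: "\<And>x. x > 0 \<Longrightarrow> ((\<lambda>l. deriv \<phi> (l * x) / deriv \<phi> l) \<longlongrightarrow> 1) at_top"
    and reg: "varies_regularly_at_infinity (deriv (\<lambda>l. l / \<phi> l)) (-1)"
  shows "\<exists>c>0. \<exists>C>0. eventually (\<lambda>l.
           c \<le> (LINT t|density_on_pos \<mu>. gauss_profile d (l * t)) / (\<phi> l - l * deriv \<phi> l) \<and>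
           (LINT t|density_on_pos \<mu>. gauss_profile d (l * t)) / (\<phi> l - l * deriv \<phi> l) \<le> C) at_top"
proof -
  obtain t0 where t0: "0 < t0" "0 < \<mu> t0" using ex_density_pos by auto
  define A where "A = (4 * real (d + 2)) ^ (d + 2) * (2 * exp 1)"
  define h where "h = deriv (\<lambda>l. l / \<phi> l)"
  have pos_ev: "eventually (\<lambda>l. 0 < l \<and> 0 < \<phi> l) at_top"
    using exponent_at_top eventually_gt_at_top[of 0]
    by (auto simp: filterlim_at_top_dense eventually_conj_iff)
  have h_eq: "h l * (\<phi> l)\<^sup>2 = \<phi> l - l * deriv \<phi> l" if "0 < l" "0 < \<phi> l" for l
  proof -
    have "((\<lambda>l. l / \<phi> l) has_real_derivative (1 * \<phi> l - l * deriv \<phi> l) / (\<phi> l * \<phi> l)) (at l)"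
      using that by (intro DERIV_divide DERIV_ident has_real_derivative_exponent) auto
    hence "h l = (1 * \<phi> l - l * deriv \<phi> l) / (\<phi> l * \<phi> l)"
      unfolding h_def by (rule DERIV_imp_deriv)
    thus ?thesis using that by (simp add: power2_eq_square)
  qed
  have exponent_ratio: "((\<lambda>l. \<phi> (x * l) / \<phi> l) \<longlongrightarrow> x) at_top" if x: "0 < x" for x
  proof (rule lhospital_at_top_at_top[OF exponent_at_top])
    \<comment> \<open>At \<open>x = 1\<close> the ratio tends to 1; it would be 0 wherever
      \<open>deriv \<phi> l\<close> vanishes, since division by zero yields 0.\<close>
    have "eventually (\<lambda>l. 0 < deriv \<phi> (l * 1) / deriv \<phi> l) at_top"
      by (rule order_tendstoD(1)[OF lim]) auto
    thus "eventually (\<lambda>l. deriv \<phi> l \<noteq> 0) at_top" by eventually_elim auto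
    show "eventually (\<lambda>l. ((\<lambda>l. \<phi> (x * l)) has_real_derivative deriv \<phi> (x * l) * x) (at l)) at_top"
      using eventually_gt_at_top[of 0]
    proof eventually_elim
      case (elim l)
      thus ?case using x
        by (intro DERIV_chain2[OF has_real_derivative_exponent]) (auto intro!: derivative_eq_intros)
    qed
    show "eventually (\<lambda>l. (\<phi> has_real_derivative deriv \<phi> l) (at l)) at_top"
      using eventually_gt_at_top[of 0] by eventually_elim (rule has_real_derivative_exponent)
    show "((\<lambda>l. deriv \<phi> (x * l) * x / deriv \<phi> l) \<longlongrightarrow> x) at_top"
      using tendsto_mult_left[OF lim[OF x], of x] by (simp add: mult.commute)
  qed
  have ratio: "((\<lambda>l. (\<phi> (x * l) - (x * l) * deriv \<phi> (x * l)) / (\<phi> l - l * deriv \<phi> l)) \<longlongrightarrow> x) at_top"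
    if x: "0 < x" for x
  proof (rule Lim_transform_eventually)
    have "((\<lambda>l. h (l * x) / h l) \<longlongrightarrow> x powr (-1)) at_top"
      using reg x by (auto simp: varies_regularly_at_infinity_def h_def)
    \<comment> \<open>By \<open>h_eq\<close> the function in question is \<open>h\<close> times the
      square of \<phi>, so the index is -1 + 2 = 1.\<close>
    hence "((\<lambda>l. h (l * x) / h l * (\<phi> (x * l) / \<phi> l)\<^sup>2) \<longlongrightarrow> x powr (-1) * x\<^sup>2) at_top"
      by (intro tendsto_mult tendsto_power exponent_ratio x)
    also have "x powr (-1) * x\<^sup>2 = x" using x by (simp add: powr_minus power2_eq_square)
    finally show "((\<lambda>l. h (l * x) / h l * (\<phi> (x * l) / \<phi> l)\<^sup>2) \<longlongrightarrow> x) at_top" .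
    have "filterlim (\<lambda>l. x * l) at_top at_top"
      using x by (intro filterlim_tendsto_pos_mult_at_top[OF tendsto_const _ filterlim_ident])
    hence "eventually (\<lambda>l. 0 < x * l \<and> 0 < \<phi> (x * l)) at_top"
      by (rule eventually_compose_filterlim[OF pos_ev])
    with pos_ev show "eventually (\<lambda>l. h (l * x) / h l * (\<phi> (x * l) / \<phi> l)\<^sup>2 =
        (\<phi> (x * l) - (x * l) * deriv \<phi> (x * l)) / (\<phi> l - l * deriv \<phi> l)) at_top"
      by eventually_elim (simp flip: h_eq add: power_divide mult.commute)
  qed
  show ?thesis
  \<comment> \<open>The two quadratic bounds give \<open>a = exp 1 / 256\<close> for
    \<open>m = 16\<close>, hence \<open>a * p = exp 1 / 16 < 1 / 4\<close>. Beyond 48 the argument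
    \<open>s / 48\<close> exceeds 1, so \<open>b = 6\<close> works and
    \<open>b * q = 1 / 8\<close>.\<close>
  proof (rule comparable_transforms[where f = gamma2_cdf and \<Phi> = "\<lambda>l. \<phi> l - l * deriv \<phi> l"
        and a = "exp 1 / 256" and b = 6 and m = 16 and k = "1 / 48" and \<epsilon> = "1 / 16" and N = 48
        and A = A and g = 0 and p = 16 and q = "1 / 48",
        OF _ _ gauss_profile_le_min[OF d] gamma2_cdf_le_min gauss_profile_pos gamma2_cdf_pos
        continuous_on_gauss_profile])
    show "gauss_profile d s \<le> s powr (-3/2)" if "1 \<le> s" for s
      using d that by (rule gauss_profile_le_tail)
    show "continuous_on {0<..} gamma2_cdf"
      unfolding gamma2_cdf_def by (intro continuous_intros)
    show "gauss_profile d s \<le> A * gamma2_cdf s" if s: "0 < s" "s \<le> 1" for s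
    proof -
      have "gauss_profile d s \<le> (4 * real (d + 2)) ^ (d + 2) * s\<^sup>2"
        using s by (rule gauss_profile_le_square)
      also have "s\<^sup>2 \<le> 2 * exp 1 * gamma2_cdf s"
        using s gamma2_cdf_ge_square[of s] by (simp add: field_simps)
      finally show ?thesis by (simp add: A_def mult.assoc mult_left_mono)
    qed
    show "gamma2_cdf s \<le> exp 1 / 256 * gamma2_cdf (16 * s)" if s: "0 < s" "s < 1 / 16" for s
      using s gamma2_cdf_le_square[of s] gamma2_cdf_ge_square[of "16 * s"]
      by (simp add: field_simps)
    show "gamma2_cdf s \<le> 6 * gamma2_cdf (1 / 48 * s)" if s: "48 < s" for s
      using s one_le_gamma2_cdf[of "1 / 48 * s"] gamma2_cdf_le_min[of s] by simp
    show "\<phi> l - l * deriv \<phi> l = 0 * l + (LINT t|density_on_pos \<mu>. gamma2_cdf (l * t))"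
      if l: "0 < l" for l
    proof -
      have "(LINT t|density_on_pos \<mu>. gamma2_cdf (l * t)) =
          (LINT t|density_on_pos \<mu>. (1 - exp (- l * t)) - l * (t * exp (- l * t)))"
        by (simp add: gamma2_cdf_def mult.assoc)
      also have "\<dots> = (LINT t|density_on_pos \<mu>. 1 - exp (- l * t)) -
          l * (LINT t|density_on_pos \<mu>. t * exp (- l * t))"
        using integrable_one_minus_exp[OF l] integrable_mult_exp[OF l]
        by (subst Bochner_Integration.integral_diff) auto
      finally show ?thesis using l by (simp add: exponent deriv_exponent algebra_simps)
    qed
    show "((\<lambda>l. (\<phi> (16 * l) - 16 * l * deriv \<phi> (16 * l)) / (\<phi> l - l * deriv \<phi> l)) \<longlongrightarrow> 16) at_top"
      by (rule ratio) simp
    show "((\<lambda>l. (\<phi> (1 / 48 * l) - 1 / 48 * l * deriv \<phi> (1 / 48 * l)) / (\<phi> l - l * deriv \<phi> l)) \<longlongrightarrow> 1 / 48) at_top"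
      by (rule ratio) simp
    show "exp 1 / 256 * 16 < (1 / 4 :: real)" using exp_le by simp
  qed (use t0 in \<open>auto simp: A_def\<close>)
qed

end

section \<open>From the subordinator to its analytic data\<close>

lemma levy_measureI:
  assumes "has_levy_measure M S \<nu>"
  shows "levy_measure \<nu>"
proof
  show sets: "sets \<nu> = sets borel" using assms by (simp add: has_levy_measure_def)
  note [measurable_cong] = sets
  have "{..0} \<in> null_sets \<nu>"
    using assms by (intro null_setsI) (auto simp: has_levy_measure_def)
  from AE_not_in[OF this] show pos: "AE t in \<nu>. 0 < t" by eventually_elim auto
  have "(\<integral>\<^sup>+t. ennreal (norm (min 1 t)) \<partial>\<nu>) = (\<integral>\<^sup>+t\<in>{0<..}. ennreal (min 1 t) \<partial>\<nu>)"
    by (rule nn_integral_cong_AE) (use pos in eventually_elim, auto)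
  also have "\<dots> < \<infinity>" using assms by (simp add: has_levy_measure_def)
  finally show "integrable \<nu> (\<lambda>t. min 1 t)" by (intro integrableI_bounded) auto
qed

text \<open>Time 1 suffices, by injectivity of \<open>exp\<close>.\<close>

lemma has_laplace_exponent_unique:
  assumes "has_laplace_exponent M S \<phi>" "has_laplace_exponent M S \<psi>" "0 < l"
  shows "\<phi> l = \<psi> l"
proof -
  have "exp (- 1 * \<phi> l) = exp (- 1 * \<psi> l)"
    using assms unfolding has_laplace_exponent_def by (metis zero_le_one)
  thus ?thesis by simp
qed

text \<open>The given \<phi> and the drift-plus-integral formula are exponents of the same process,
  so they agree on the positive axis.\<close>

lemma laplace_exponentI:
  assumes "has_laplace_exponent M S \<phi>" "has_levy_measure M S (density_on_pos \<mu>)"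
    and "\<And>t. t > 0 \<Longrightarrow> \<mu> t \<ge> 0" "antimono_on {0<..} \<mu>"
    and "emeasure (density_on_pos \<mu>) {0<..} = \<infinity>"
  obtains \<gamma> where "laplace_exponent \<mu> \<gamma> \<phi>"
proof -
  interpret levy_measure "density_on_pos \<mu>" using assms(2) by (rule levy_measureI)
  obtain \<gamma> where \<gamma>: "0 \<le> \<gamma>" and
    exponent: "has_laplace_exponent M S
       (\<lambda>l. \<gamma> * l + (LINT t:{0<..}|density_on_pos \<mu>. 1 - exp (- l * t)))"
    using assms(2) unfolding has_levy_measure_def by blast
  have "\<phi> l = \<gamma> * l + (LINT t|density_on_pos \<mu>. 1 - exp (- l * t))" if "0 < l" for l
  proof -
    have "(LINT t:{0<..}|density_on_pos \<mu>. 1 - exp (- l * t)) = (LINT t|density_on_pos \<mu>. 1 - exp (- l * t))"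
      unfolding set_lebesgue_integral_def
      by (rule integral_cong_AE) (use AE_pos in \<open>measurable, eventually_elim, simp\<close>)
    thus ?thesis using has_laplace_exponent_unique[OF assms(1) exponent that] by simp
  qed
  hence "laplace_exponent \<mu> \<gamma> \<phi>"
    by unfold_locales (use assms \<gamma> in auto)
  thus thesis by (rule that)
qed

section \<open>Brownian scaling and the passage to small radii\<close>

text \<open>The heat kernel at time \<open>t\<close> and distance \<open>r\<close> is
  \<open>r powr (- d)\<close> times the one at time \<open>t / r\<^sup>2\<close> and distance 1. The
  identity is applied pointwise under the integral, with \<open>t\<close> kept as the
  variable.\<close>

lemma (in decreasing_levy_density) sbm_jump_eq:
  assumes r: "0 < r"
  shows "sbm_jump d \<mu> r = (4 * pi) powr (- real d / 2) * r powr (- real d) *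
           (LINT t|density_on_pos \<mu>. gauss_profile d (r powr (-2) * t))"
proof -
  have pointwise: "(4 * pi * t) powr (- real d / 2) * exp (- r\<^sup>2 / (4 * t)) =
      (4 * pi) powr (- real d / 2) * r powr (- real d) * gauss_profile d (r powr (-2) * t)"
    if "0 < t" for t
  proof -
    have "(r powr (-2) * t) powr (- real d / 2) = r powr real d * t powr (- real d / 2)"
      using that r by (simp add: powr_mult powr_powr)
    moreover have "r powr (- real d) * r powr real d = 1"
      using r by (simp flip: powr_add)
    moreover have "- 1 / (4 * (r powr (-2) * t)) = - r\<^sup>2 / (4 * t)"
      using r that by (simp add: powr_minus divide_simps)
    ultimately show ?thesis
      using that by (simp add: gauss_profile_def powr_mult)
  qed
  have "AE t in density_on_pos \<mu>. (4 * pi * t) powr (- real d / 2) * exp (- r\<^sup>2 / (4 * t)) =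
      (4 * pi) powr (- real d / 2) * r powr (- real d) * gauss_profile d (r powr (-2) * t)"
    using AE_pos by eventually_elim (rule pointwise)
  hence "(LINT t|density_on_pos \<mu>. (4 * pi * t) powr (- real d / 2) * exp (- r\<^sup>2 / (4 * t))) =
      (LINT t|density_on_pos \<mu>. (4 * pi) powr (- real d / 2) * r powr (- real d) * gauss_profile d (r powr (-2) * t))"
    by (intro integral_cong_AE) measurable
  also have "\<dots> = (4 * pi) powr (- real d / 2) * r powr (- real d) *
      (LINT t|density_on_pos \<mu>. gauss_profile d (r powr (-2) * t))"
    by (rule integral_mult_right_zero)
  also have "(LINT t|density_on_pos \<mu>. (4 * pi * t) powr (- real d / 2) * exp (- r\<^sup>2 / (4 * t))) =
      sbm_jump d \<mu> r"
    unfolding sbm_jump_def by (rule integral_density_on_pos) measurable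
  finally show ?thesis .
qed

text \<open>The map from \<open>r\<close> to \<open>r powr (-2)\<close> carries 0+ to infinity, and
  the common factor \<open>r powr (- d)\<close> cancels in the quotient.\<close>

lemma (in decreasing_levy_density) comparable_at_zeroI:
  assumes ev: "\<exists>c>0. \<exists>C>0. eventually (\<lambda>l.
           c \<le> (LINT t|density_on_pos \<mu>. gauss_profile d (l * t)) / \<Phi> l \<and>
           (LINT t|density_on_pos \<mu>. gauss_profile d (l * t)) / \<Phi> l \<le> C) at_top"
    and g: "\<And>r. 0 < r \<Longrightarrow> g r = r powr (- real d) * \<Phi> (r powr (-2))"
  shows "comparable_at_zero (sbm_jump d \<mu>) g"
proof -
  define J where "J l = (LINT t|density_on_pos \<mu>. gauss_profile d (l * t))" for l
  define k where "k = (4 * pi) powr (- real d / 2)"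
  have k: "0 < k" by (simp add: k_def)
  obtain c C where "0 < c" "0 < C" and ev': "eventually (\<lambda>l. c \<le> J l / \<Phi> l \<and> J l / \<Phi> l \<le> C) at_top"
    using ev unfolding J_def by blast
  have "filterlim (\<lambda>r::real. r powr (-2)) at_top (at_right 0)" by real_asymp
  from eventually_compose_filterlim[OF ev' this] eventually_at_right_less[of 0]
  have "eventually (\<lambda>r. k * c \<le> sbm_jump d \<mu> r / g r \<and> sbm_jump d \<mu> r / g r \<le> k * C) (at_right 0)"
  proof eventually_elim
    case (elim r)
    have "sbm_jump d \<mu> r / g r = k * (J (r powr (-2)) / \<Phi> (r powr (-2)))"
      using elim(2) by (simp add: sbm_jump_eq g J_def k_def)
    moreover have "k * c \<le> k * (J (r powr (-2)) / \<Phi> (r powr (-2)))"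
      "k * (J (r powr (-2)) / \<Phi> (r powr (-2))) \<le> k * C"
      using elim(1) k by (intro mult_left_mono; simp)+
    ultimately show ?case by simp
  qed
  thus ?thesis
    unfolding comparable_at_zero_def using k \<open>0 < c\<close> \<open>0 < C\<close>
    by (intro exI[of _ "k * c"] exI[of _ "k * C"] conjI) auto
qed

theorem theorem4p1:
  fixes M :: "'w measure"
    and B X :: "real \<Rightarrow> 'w \<Rightarrow> real ^ 'n"
    and S :: "real \<Rightarrow> 'w \<Rightarrow> real"
    and \<phi> \<mu> :: "real \<Rightarrow> real"
    and \<alpha> :: real
  assumes dim: "CARD('n) \<ge> 3"
    and S: "subordinator M S"
    and \<phi>: "has_laplace_exponent M S \<phi>"
    and \<alpha>: "0 \<le> \<alpha>" "\<alpha> \<le> 2"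
    and \<phi>': "\<And>x. x > 0 \<Longrightarrow>
               ((\<lambda>l. deriv \<phi> (l * x) / deriv \<phi> l) \<longlongrightarrow> x powr (\<alpha> / 2 - 1)) at_top"
    and \<mu>_nonneg: "\<And>t. t > 0 \<Longrightarrow> \<mu> t \<ge> 0"
    and \<mu>_decreasing: "antimono_on {0<..} \<mu>"
    and \<mu>_levy: "has_levy_measure M S (density_on_pos \<mu>)"
    and \<mu>_infinite: "emeasure (density_on_pos \<mu>) {0<..} = \<infinity>"
    and X: "subordinate_brownian_motion M B S X"
  shows "(\<alpha> < 2 \<longrightarrow>
            comparable_at_zero (sbm_jump CARD('n) \<mu>)
              (\<lambda>r. r powr (- real CARD('n) - 2) * deriv \<phi> (r powr (-2)))) \<and>
         (\<alpha> = 2 \<and> varies_regularly_at_infinity (deriv (\<lambda>l. l / \<phi> l)) (-1) \<longrightarrow>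
            comparable_at_zero (sbm_jump CARD('n) \<mu>)
              (\<lambda>r. r powr (- real CARD('n) - 2) * (r\<^sup>2 * \<phi> (r powr (-2)) - deriv \<phi> (r powr (-2)))))"
proof -
  obtain \<gamma> where "laplace_exponent \<mu> \<gamma> \<phi>"
    using laplace_exponentI[OF \<phi> \<mu>_levy \<mu>_nonneg \<mu>_decreasing \<mu>_infinite] .
  then interpret laplace_exponent \<mu> \<gamma> \<phi> .
  \<comment> \<open>The extra \<open>r powr (-2)\<close> is the factor \<open>l\<close> of
    \<open>l * deriv \<phi> l\<close>; in the second regime it cancels the \<open>r\<^sup>2\<close>
    before \<phi>.\<close>
  have r_powr: "r powr (- real CARD('n) - 2) = r powr (- real CARD('n)) * r powr (-2)" for r :: real
    by (simp flip: powr_add)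
  have "comparable_at_zero (sbm_jump CARD('n) \<mu>)
      (\<lambda>r. r powr (- real CARD('n) - 2) * deriv \<phi> (r powr (-2)))" if "\<alpha> < 2"
    using that dim \<phi>' \<alpha>
    by (intro comparable_at_zeroI[OF comparable_case_less]) (auto simp: r_powr)
  moreover have "comparable_at_zero (sbm_jump CARD('n) \<mu>)
      (\<lambda>r. r powr (- real CARD('n) - 2) * (r\<^sup>2 * \<phi> (r powr (-2)) - deriv \<phi> (r powr (-2))))"
    if "\<alpha> = 2" "varies_regularly_at_infinity (deriv (\<lambda>l. l / \<phi> l)) (-1)"
  proof (rule comparable_at_zeroI[OF comparable_case_two])
    show "((\<lambda>l. deriv \<phi> (l * x) / deriv \<phi> l) \<longlongrightarrow> 1) at_top" if "0 < x" for x
      using \<phi>'[OF that] that \<open>\<alpha> = 2\<close> by simp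
    show "r powr (- real CARD('n) - 2) * (r\<^sup>2 * \<phi> (r powr (-2)) - deriv \<phi> (r powr (-2))) =
        r powr (- real CARD('n)) * (\<phi> (r powr (-2)) - r powr (-2) * deriv \<phi> (r powr (-2)))"
      if "0 < r" for r
      unfolding r_powr using that by (simp add: powr_minus algebra_simps)
  qed (use dim that in auto)
  ultimately show ?thesis by blast
qed

end
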